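(* Let $(X,\mathcal{E})$ be a coarse space with $X$ nonempty. Then every bornologous mapping $f: X\to X$ (from $(X,\mathcal{E})$ to itself) is macro-uniform if and only if $(X,\mathcal{E})$ is discrete.
   Context: A coarse structure on a set $X$ is a family $\mathcal{E}$ of subsets of $X\times X$ such that: (1) each $E\in\mathcal{E}$ contains the diagonal $\triangle_X=\{(x,x): x\in X\}$; (2) if $E,E'\in\mathcal{E}$ then $E\circ E'\in\mathcal{E}$ and $E^{-1}\in\mathcal{E}$, where $E\circ E'=\{(x,y): \exists z\ ((x,z)\in E,\ (z,y)\in E')\}$ and $E^{-1}=\{(y,x): (x,y)\in E\}$; (3) if $E\in\mathcal{E}$ and $\triangle_X\subseteq E'\subseteq E$ then $E'\in\mathcal{E}$; (4) $\bigcup\mathcal{E}=X\times X$. The pair $(X,\mathcal{E})$ is called a coarse space. For $x\in X$ and $E\in\mathcal{E}$, put $E[x]=\{y\in X: (x,y)\in E\}$. A subset $B\subseteq X$ is bounded if $B\subseteq E[x]$ for some $E\in\mathcal{E}$ and $x\in X$; the family of all bounded subsets is denoted $\mathcal{B}_{(X,\mathcal{E})}$. A mapping $f: X\to X'$ between coarse spaces $(X,\mathcal{E})$ and $(X',\mathcal{E}')$ is bornologous if $f(B)\in\mathcal{B}_{(X',\mathcal{E}')}$ for each $B\in\mathcal{B}_{(X,\mathcal{E})}$. It is macro-uniform if for each $E\in\mathcal{E}$ there exists $E'\in\mathcal{E}'$ such that, for all $x,y\in X$, $(x,y)\in E$ implies $(f(x),f(y))\in E'$. A coarse space $(X,\mathcal{E})$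 is discrete if for each $E\in\mathcal{E}$ there exists $B\in\mathcal{B}_{(X,\mathcal{E})}$ such that $E[x]=\{x\}$ for each $x\in X\setminus B$. *)

theory Defs
  imports Main "HOL-Library.FuncSet"
begin

(* Relational composition \<open>E O E'\<close>, the converse and the image \<open>E `` {x}\<close> are the library's; they are
   oriented as in the usual coarse-geometry conventions: (x, y) \<in> E O E' iff (x, z) \<in> E and (z, y) \<in> E'
   for some z, and y \<in> E `` {x}, written E[x] in print, iff (x, y) \<in> E. *)

definition coarse_space :: "'a set \<Rightarrow> ('a \<times> 'a) set set \<Rightarrow> bool" where
  "coarse_space X \<E> \<longleftrightarrow>
     \<E> \<subseteq> Pow (X \<times> X) \<and>
     (\<forall>E\<in>\<E>. Id_on X \<subseteq> E) \<and>
     (\<forall>E\<in>\<E>. \<forall>E'\<in>\<E>. E O E' \<in> \<E>) \<and>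
     (\<forall>E\<in>\<E>. E\<inverse> \<in> \<E>) \<and>
     (\<forall>E\<in>\<E>. \<forall>E'. Id_on X \<subseteq> E' \<and> E' \<subseteq> E \<longrightarrow> E' \<in> \<E>) \<and>
     \<Union>\<E> = X \<times> X"

definition coarse_bounded :: "'a set \<Rightarrow> ('a \<times> 'a) set set \<Rightarrow> 'a set set" where
  "coarse_bounded X \<E> = {B. B \<subseteq> X \<and> (\<exists>E\<in>\<E>. \<exists>x\<in>X. B \<subseteq> E `` {x})}"

(* A mapping X \<rightarrow> X' is a total function on the ambient type of which only the values on X matter. *)

definition bornologous ::
    "'a set \<Rightarrow> ('a \<times> 'a) set set \<Rightarrow> 'b set \<Rightarrow> ('b \<times> 'b) set set \<Rightarrow> ('a \<Rightarrow> 'b) \<Rightarrow> bool" where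
  "bornologous X \<E> X' \<E>' f \<longleftrightarrow>
     f \<in> X \<rightarrow> X' \<and> (\<forall>B\<in>coarse_bounded X \<E>. f ` B \<in> coarse_bounded X' \<E>')"

definition macro_uniform ::
    "'a set \<Rightarrow> ('a \<times> 'a) set set \<Rightarrow> 'b set \<Rightarrow> ('b \<times> 'b) set set \<Rightarrow> ('a \<Rightarrow> 'b) \<Rightarrow> bool" where
  "macro_uniform X \<E> X' \<E>' f \<longleftrightarrow>
     f \<in> X \<rightarrow> X' \<and>
     (\<forall>E\<in>\<E>. \<exists>E'\<in>\<E>'. \<forall>x\<in>X. \<forall>y\<in>X. (x, y) \<in> E \<longrightarrow> (f x, f y) \<in> E')"

definition coarse_discrete :: "'a set \<Rightarrow> ('a \<times> 'a) set set \<Rightarrow> bool" where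
  "coarse_discrete X \<E> \<longleftrightarrow>
     (\<forall>E\<in>\<E>. \<exists>B\<in>coarse_bounded X \<E>. \<forall>x\<in>X - B. E `` {x} = {x})"

end

theory Submission
  imports Defs
begin

text \<open>
  If the space is discrete, an entourage differs from the diagonal only on a bounded set, whose image
  under a bornologous map is bounded.
  Conversely, regard a symmetric entourage \<open>F\<close> as a graph on \<open>X\<close>, let \<open>J\<close> be a maximal
  independent set of vertices, and let \<open>f\<close> collapse \<open>J\<close> to a point \<open>p\<close> and fix everything
  else. Then \<open>f\<close> is bornologous, hence macro-uniform. Every vertex outside \<open>J\<close> has a neighbour in
  \<open>J\<close>, so \<open>X - J\<close> lies within a bounded distance of \<open>p\<close>; every vertex of \<open>J\<close> that is not
  isolated has a neighbour in \<open>X - J\<close>. So the set of all vertices that are not isolated is bounded.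
\<close>

text \<open>Zorn's lemma gives an independent set maximal under inclusion. Such a set dominates the
  graph, since a vertex with no neighbour in it could be added. Loops are tolerated because
  entourages are reflexive.\<close>

lemma maximal_independent_set:
  assumes "sym F"
  obtains J where "J \<subseteq> X" and "\<And>x y. x \<in> J \<Longrightarrow> y \<in> J \<Longrightarrow> (x, y) \<in> F \<Longrightarrow> x = y"
    and "\<And>x. x \<in> X - J \<Longrightarrow> \<exists>y\<in>J. (y, x) \<in> F"
proof -
  define \<A> where "\<A> = {J. J \<subseteq> X \<and> (\<forall>x\<in>J. \<forall>y\<in>J. (x, y) \<in> F \<longrightarrow> x = y)}"
  have "\<exists>M\<in>\<A>. \<forall>J\<in>\<A>. M \<subseteq> J \<longrightarrow> J = M"
  proof (rule subset_Zorn')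
    fix C assume C: "subset.chain \<A> C"
    \<comment> \<open>Two elements of the union of a chain already lie in one common member, which
      is independent.\<close>
    have "x = y" if xy: "x \<in> \<Union>C" "y \<in> \<Union>C" "(x, y) \<in> F" for x y
    proof -
      obtain K L where KL: "K \<in> C" "x \<in> K" "L \<in> C" "y \<in> L"
        using xy by blast
      then obtain M where "M \<in> C" "x \<in> M" "y \<in> M"
        using C unfolding subset_chain_def by blast
      then show ?thesis
        using C xy(3) unfolding subset_chain_def \<A>_def by blast
    qed
    then show "\<Union>C \<in> \<A>"
      using C unfolding subset_chain_def \<A>_def by blast
  qed
  then obtain J where J: "J \<in> \<A>" and max: "\<And>K. K \<in> \<A> \<Longrightarrow> J \<subseteq> K \<Longrightarrow> K = J"
    by blast
  have "\<exists>y\<in>J. (y, x) \<in> F" if x: "x \<in> X - J" for x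
  proof (rule ccontr)
    assume "\<not> ?thesis"
    \<comment> \<open>Edges from \<open>J\<close> to \<open>x\<close> are excluded by assumption,
      edges from \<open>x\<close> to \<open>J\<close> by symmetry.\<close>
    then have "insert x J \<in> \<A>"
      using J x symD[OF assms] unfolding \<A>_def by blast
    then show False
      using max[of "insert x J"] x by blast
  qed
  then show thesis
    using J that[of J] unfolding \<A>_def by blast
qed

locale coarse =
  fixes X :: "'a set" and \<E> :: "('a \<times> 'a) set set"
  assumes coarse_space: "coarse_space X \<E>"
begin

lemma entourage_subset: "E \<in> \<E> \<Longrightarrow> E \<subseteq> X \<times> X"
  using coarse_space unfolding coarse_space_def by (meson PowD subsetD)

lemma entourage_comp: "E \<in> \<E> \<Longrightarrow> E' \<in> \<E> \<Longrightarrow> E O E' \<in> \<E>"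
  using coarse_space unfolding coarse_space_def by meson

lemma entourage_converse: "E \<in> \<E> \<Longrightarrow> E\<inverse> \<in> \<E>"
  using coarse_space unfolding coarse_space_def by meson

lemma entourage_refl: "E \<in> \<E> \<Longrightarrow> x \<in> X \<Longrightarrow> (x, x) \<in> E"
  using coarse_space Id_onI[of x X] unfolding coarse_space_def by (meson subsetD)

lemma entourage_exists:
  assumes "x \<in> X" "y \<in> X"
  shows "\<exists>E\<in>\<E>. (x, y) \<in> E"
proof -
  have "(x, y) \<in> \<Union>\<E>"
    using coarse_space assms unfolding coarse_space_def by simp
  then show ?thesis
    by blast
qed

lemma coarse_boundedI:
  "E \<in> \<E> \<Longrightarrow> x \<in> X \<Longrightarrow> B \<subseteq> E `` {x} \<Longrightarrow> B \<in> coarse_bounded X \<E>"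
  using entourage_subset unfolding coarse_bounded_def by blast

lemma coarse_boundedE:
  assumes "B \<in> coarse_bounded X \<E>"
  obtains E x where "E \<in> \<E>" "x \<in> X" "B \<subseteq> E `` {x}" "B \<subseteq> X"
  using assms unfolding coarse_bounded_def by blast

lemma coarse_bounded_subset:
  "B \<in> coarse_bounded X \<E> \<Longrightarrow> B' \<subseteq> B \<Longrightarrow> B' \<in> coarse_bounded X \<E>"
  unfolding coarse_bounded_def by blast

text \<open>Some entourage joins the centre \<open>x\<close> to \<open>p\<close>, because the
  entourages cover X \<times> X. By reflexivity, its composite with \<open>E\<close> reaches both
  \<open>p\<close> and \<open>B\<close> from \<open>x\<close>.\<close>

lemma coarse_bounded_insert:
  assumes B: "B \<in> coarse_bounded X \<E>" and p: "p \<in> X"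
  shows "insert p B \<in> coarse_bounded X \<E>"
proof -
  obtain E x where E: "E \<in> \<E>" "x \<in> X" "B \<subseteq> E `` {x}" "B \<subseteq> X"
    using B by (rule coarse_boundedE)
  obtain D where D: "D \<in> \<E>" "(x, p) \<in> D"
    using entourage_exists E(2) p by blast
  have "insert p B \<subseteq> (E O D) `` {x}"
    using E D entourage_refl[OF E(1) E(2)] entourage_refl[OF D(1)] by blast
  then show ?thesis
    using coarse_boundedI entourage_comp E D by blast
qed

lemma coarse_bounded_Image:
  assumes B: "B \<in> coarse_bounded X \<E>" and F: "F \<in> \<E>"
  shows "F `` B \<in> coarse_bounded X \<E>"
proof -
  obtain E x where E: "E \<in> \<E>" "x \<in> X" "B \<subseteq> E `` {x}" "B \<subseteq> X"
    using B by (rule coarse_boundedE)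
  then have "F `` B \<subseteq> (E O F) `` {x}"
    by blast
  then show ?thesis
    using coarse_boundedI entourage_comp E F by blast
qed

text \<open>Any two points of \<open>B\<close> are linked through the common centre.\<close>

lemma coarse_bounded_square:
  assumes "B \<in> coarse_bounded X \<E>"
  shows "\<exists>E\<in>\<E>. B \<times> B \<subseteq> E"
proof -
  obtain E x where E: "E \<in> \<E>" "x \<in> X" "B \<subseteq> E `` {x}" "B \<subseteq> X"
    using assms by (rule coarse_boundedE)
  then have "B \<times> B \<subseteq> E\<inverse> O E"
    by blast
  then show ?thesis
    using entourage_comp entourage_converse E by blast
qed

end

lemma bornologous_imp_macro_uniform:
  assumes X: "coarse_space X \<E>" and X': "coarse_space X' \<E>'"
    and disc: "coarse_discrete X \<E>" and f: "bornologous X \<E> X' \<E>' f"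
  shows "macro_uniform X \<E> X' \<E>' f"
proof -
  interpret X: coarse X \<E> by (rule coarse.intro[OF X])
  interpret X': coarse X' \<E>' by (rule coarse.intro[OF X'])
  have fX: "f \<in> X \<rightarrow> X'"
    using f unfolding bornologous_def by blast
  have "\<exists>E'\<in>\<E>'. \<forall>x\<in>X. \<forall>y\<in>X. (x, y) \<in> E \<longrightarrow> (f x, f y) \<in> E'" if E: "E \<in> \<E>" for E
  proof -
    obtain B where B: "B \<in> coarse_bounded X \<E>" "\<And>x. x \<in> X - B \<Longrightarrow> E `` {x} = {x}"
      using disc E unfolding coarse_discrete_def by metis
    have "f ` (E `` B) \<in> coarse_bounded X' \<E>'"
      using f X.coarse_bounded_Image[OF B(1) E] unfolding bornologous_def by simp
    then obtain E' where E': "E' \<in> \<E>'" "f ` (E `` B) \<times> f ` (E `` B) \<subseteq> E'"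
      using X'.coarse_bounded_square by metis
    have "(f x, f y) \<in> E'" if xy: "x \<in> X" "y \<in> X" "(x, y) \<in> E" for x y
    proof (cases "x \<in> B")
      case True
      then show ?thesis
        using E'(2) xy X.entourage_refl[OF E xy(1)] by blast
    next
      case False
      then have "y = x"
        using B(2)[of x] xy by blast
      then show ?thesis
        using X'.entourage_refl[OF E'(1)] funcset_mem[OF fX xy(1)] by simp
    qed
    then show ?thesis
      using E'(1) by blast
  qed
  then show ?thesis
    using fX unfolding macro_uniform_def by blast
qed

text \<open>The collapse adds at most the point \<open>p\<close> to a set.\<close>

lemma (in coarse) bornologous_collapse:
  assumes p: "p \<in> X"
  shows "bornologous X \<E> X \<E> (\<lambda>x. if x \<in> J then p else x)"
proof -
  have "(\<lambda>x. if x \<in> J then p else x) ` B \<in> coarse_bounded X \<E>" if "B \<in> coarse_bounded X \<E>" for B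
    by (rule coarse_bounded_subset[OF coarse_bounded_insert[OF that p]]) auto
  then show ?thesis
    using p unfolding bornologous_def by auto
qed

lemma (in coarse) coarse_discreteI:
  assumes p: "p \<in> X"
    and unif: "\<And>f. bornologous X \<E> X \<E> f \<Longrightarrow> macro_uniform X \<E> X \<E> f"
  shows "coarse_discrete X \<E>"
  unfolding coarse_discrete_def
proof
  fix E assume E: "E \<in> \<E>"
  \<comment> \<open>This makes \<open>E\<close> symmetric by composition alone; reflexivity keeps
    \<open>E\<close> inside \<open>F\<close>.\<close>
  define F where "F = E O E\<inverse>"
  have F: "F \<in> \<E>"
    unfolding F_def by (rule entourage_comp[OF E entourage_converse[OF E]])
  have "sym F"
    unfolding F_def sym_def by blast
  have EF: "E \<subseteq> F"
  proof (rule subrelI)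
    fix x y assume xy: "(x, y) \<in> E"
    then have "(y, y) \<in> E\<inverse>"
      using entourage_refl[OF E, of y] entourage_subset[OF E] by blast
    then show "(x, y) \<in> F"
      using xy unfolding F_def by blast
  qed
  obtain J where J: "J \<subseteq> X" "\<And>x y. x \<in> J \<Longrightarrow> y \<in> J \<Longrightarrow> (x, y) \<in> F \<Longrightarrow> x = y"
    "\<And>x. x \<in> X - J \<Longrightarrow> \<exists>y\<in>J. (y, x) \<in> F"
    using maximal_independent_set[OF \<open>sym F\<close>, of X] by metis
  define f where "f = (\<lambda>x. if x \<in> J then p else x)"
  have "macro_uniform X \<E> X \<E> f"
    unfolding f_def by (rule unif[OF bornologous_collapse[OF p]])
  then obtain E' where E': "E' \<in> \<E>" "\<forall>x\<in>X. \<forall>y\<in>X. (x, y) \<in> F \<longrightarrow> (f x, f y) \<in> E'"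
    using F unfolding macro_uniform_def by meson
  \<comment> \<open>The neighbour of \<open>x\<close> in \<open>J\<close> is sent to
    \<open>p\<close> while \<open>x\<close> stays fixed, so the edge between them maps to (p,
    x).\<close>
  have "x \<in> E' `` {p}" if x: "x \<in> X - J" for x
  proof -
    obtain y where "y \<in> J" "(y, x) \<in> F"
      using J(3)[OF x] by blast
    then show ?thesis
      using E'(2) J(1) x unfolding f_def by force
  qed
  then have N: "X - J \<in> coarse_bounded X \<E>"
    using coarse_boundedI[OF E'(1) p] by blast
  \<comment> \<open>The set removed contains X - J, as \<open>F\<close> is reflexive, and all
    neighbours of X - J. A remaining \<open>x\<close> thus lies in \<open>J\<close> and has
    neighbours only in \<open>J\<close>, and independence leaves just \<open>x\<close>
    itself.\<close>
  have "E `` {x} = {x}" if x: "x \<in> X - F `` (X - J)" for x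
  proof -
    have "x \<in> J"
      using x entourage_refl[OF F, of x] by blast
    then have "y = x" if "(x, y) \<in> F" for y
      using that x J(2) symD[OF \<open>sym F\<close> that] entourage_subset[OF F] by blast
    then show ?thesis
      using EF entourage_refl[OF E, of x] x by blast
  qed
  then show "\<exists>B\<in>coarse_bounded X \<E>. \<forall>x\<in>X - B. E `` {x} = {x}"
    by (rule bexI[OF ballI coarse_bounded_Image[OF N F]])
qed

theorem theorem1:
  fixes X :: "'a set" and \<E> :: "('a \<times> 'a) set set"
  assumes "coarse_space X \<E>" and "X \<noteq> {}"
  shows "(\<forall>f. bornologous X \<E> X \<E> f \<longrightarrow> macro_uniform X \<E> X \<E> f) \<longleftrightarrow> coarse_discrete X \<E>"
proof
  obtain p where p: "p \<in> X"
    using assms(2) by blast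
  assume "\<forall>f. bornologous X \<E> X \<E> f \<longrightarrow> macro_uniform X \<E> X \<E> f"
  then show "coarse_discrete X \<E>"
    using coarse.coarse_discreteI[OF coarse.intro[OF assms(1)] p] by simp
next
  assume "coarse_discrete X \<E>"
  then show "\<forall>f. bornologous X \<E> X \<E> f \<longrightarrow> macro_uniform X \<E> X \<E> f"
    using bornologous_imp_macro_uniform[OF assms(1) assms(1)] by simp
qed

end
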